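(* Let $F$ be a preordered semifield with preorder $\le$. Then $\le$ is the intersection of all total semifield preorders on $F$ which extend it. In other words, for all $x,y\in F$ we have $x\le y$ if and only if $x\preceq y$ for every total semifield preorder $\preceq$ on $F$ that extends $\le$.
   Context: All structures are commutative. A semiring is a set with operations $+,\cdot$ and elements $0,1$ such that $(S,+,0)$ and $(S,\cdot,1)$ are commutative monoids, multiplication distributes over addition, and $0\cdot x=0$. A semifield is a semiring with $1\neq 0$ in which every nonzero element is multiplicatively invertible. A semifield is strict if it is not a field (equivalently, $x+y=0$ implies $x=y=0$). A semiring preorder on a semiring $S$ is a reflexive and transitive relation $\le$ such that $x\le y$ implies $a+x\le a+y$ and $ax\le ay$ for all $a,x,y\in S$. A preordered semifield is a strict semifield $F$ with a semiring preorder $\le$ such that it is not the case that both $1\le 0$ and $0\le 1$; such a preorder is called a semifield preorder on $F$. A preorder $\preceq$ is total if for all $x,y$ we have $x\preceq y$ or $y\preceq x$. A preorder $\preceq$ extends $\le$ if $a\le b$ implies $a\preceq b$. *)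

theory Defs
  imports Main
begin

class semifield = comm_semiring_1 +
  assumes ex_mult_inverse: "x \<noteq> 0 \<Longrightarrow> \<exists>y. x * y = 1"

text \<open>A semifield is a field exactly when every element has an additive inverse.\<close>

class strict_semifield = semifield +
  assumes not_field: "\<not> (\<forall>x. \<exists>y. x + y = 0)"

lemma (in strict_semifield) add_eq_0_imp:
  assumes "x + y = 0"
  shows "x = 0 \<and> y = 0"
proof -
  have *: "a = 0" if ab: "a + b = 0" for a b
  proof (rule ccontr)
    assume "a \<noteq> 0"
    then obtain c where c: "a * c = 1" using ex_mult_inverse by blast
    have "z + b * c * z = 0" for z
    proof -
      have "z + b * c * z = (a * c) * z + b * c * z" by (simp add: c)
      also have "\<dots> = (a + b) * (c * z)" by (simp add: distrib_right mult.assoc)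
      finally show ?thesis by (simp add: ab)
    qed
    then show False using not_field by blast
  qed
  show ?thesis using *[of x y] *[of y x] assms by (simp add: add.commute)
qed

definition semiring_preorder :: "('a::comm_semiring_1 \<Rightarrow> 'a \<Rightarrow> bool) \<Rightarrow> bool" where
  "semiring_preorder le \<longleftrightarrow>
     reflp le \<and> transp le \<and>
     (\<forall>a x y. le x y \<longrightarrow> le (a + x) (a + y) \<and> le (a * x) (a * y))"

definition semifield_preorder :: "('a::strict_semifield \<Rightarrow> 'a \<Rightarrow> bool) \<Rightarrow> bool" where
  "semifield_preorder le \<longleftrightarrow> semiring_preorder le \<and> \<not> (le 1 0 \<and> le 0 1)"

text \<open>
  The library predicate \<^const>\<open>totalp\<close> only compares distinct elements; on reflexive
  relations it agrees with totality in the sense that any two elements are comparable.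
\<close>

lemma totalp_semifield_preorder_iff:
  "semifield_preorder le \<Longrightarrow> totalp le \<longleftrightarrow> (\<forall>x y. le x y \<or> le y x)"
  unfolding semifield_preorder_def semiring_preorder_def totalp_on_def reflp_def
  by (metis UNIV_I)

end

theory Submission
  imports Defs "HOL-Computational_Algebra.Polynomial"
begin

text \<open>
  Suppose \<open>x \<le> y\<close> fails. By Zorn's lemma there is a semiring preorder that is maximal among the
  extensions of \<open>\<le>\<close> for which it still fails, and the point is that such a maximal preorder is
  total. It is a semifield preorder for free: \<open>1 \<le> 0 \<le> 1\<close> would relate every two elements.

  For totality, the preorder obtained from \<open>\<le>\<close> by forcing \<open>a \<le> b\<close> has an explicit description:
  \<open>x\<close> lies below \<open>y\<close> in it iff \<open>x \<le> p(a)\<close> and \<open>p(b) \<le> y\<close> for some polynomial \<open>p\<close> over the semifield.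
  Composing two such relations, witnessed by \<open>p\<close> and \<open>q\<close>, is possible thanks to division: the
  witness is the polynomial \<open>p \<cdot> q / q(a)\<close> if \<open>q(a) \<noteq> 0\<close>, and \<open>p + q\<close> otherwise (lemma \<open>adjoin_trans\<close>).

  Forcing \<open>a \<le> b\<close> and forcing \<open>b \<le> a\<close> cannot both create the same new inequality (lemma
  \<open>adjoin_both_imp\<close>). Indeed let \<open>x \<le> p(a)\<close>, \<open>p(b) \<le> y\<close>, \<open>x \<le> q(b)\<close> and \<open>q(a) \<le> y\<close>, and let \<open>P\<close> and
  \<open>Q\<close> be the divided differences \<open>(p(a) - p(b)) / (a - b)\<close> and \<open>(q(a) - q(b)) / (a - b)\<close>, which
  as polynomial expressions in \<open>a\<close>, \<open>b\<close> and the coefficients involve no subtraction. Then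
  \<open>Q p(a) + P q(b) = Q p(b) + P q(a)\<close>, so that \<open>(Q + P) x \<le> (Q + P) y\<close>, and \<open>Q + P\<close> can be divided
  out unless it vanishes; in that case strictness makes \<open>p(a) = p(b)\<close>.
  Hence if a maximal preorder left \<open>a\<close> and \<open>b\<close> incomparable, then both forcings would enlarge it,
  both would relate \<open>x\<close> to \<open>y\<close> by maximality, and \<open>x\<close> would be related to \<open>y\<close> already.
\<close>

section \<open>Strict semifields and their preorders\<close>

lemma semifield_mult_eq_0_imp:
  fixes x y :: "'a::semifield"
  assumes "x * y = 0"
  shows "x = 0 \<or> y = 0"
proof (cases "x = 0")
  case False
  then obtain z where "x * z = 1" using ex_mult_inverse by blast
  then have "y = (x * y) * z" by (metis mult.commute mult.left_commute mult_1_right)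
  then show ?thesis using assms by simp
qed simp

lemma strict_semifield_sum_eq_0_imp:
  fixes f :: "'b \<Rightarrow> 'a::strict_semifield"
  assumes "finite A" "sum f A = 0" "i \<in> A"
  shows "f i = 0"
  using assms by (metis add_eq_0_imp sum.remove)

lemma semiring_preorder_refl: "semiring_preorder le \<Longrightarrow> le x x"
  by (simp add: semiring_preorder_def reflp_def)

lemma semiring_preorder_trans: "semiring_preorder le \<Longrightarrow> le x y \<Longrightarrow> le y z \<Longrightarrow> le x z"
  unfolding semiring_preorder_def transp_def by blast

lemma semiring_preorder_add_left: "semiring_preorder le \<Longrightarrow> le x y \<Longrightarrow> le (c + x) (c + y)"
  by (simp add: semiring_preorder_def)

lemma semiring_preorder_mult_left: "semiring_preorder le \<Longrightarrow> le x y \<Longrightarrow> le (c * x) (c * y)"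
  by (simp add: semiring_preorder_def)

lemma semiring_preorder_add_mono:
  assumes "semiring_preorder le" "le x y" "le u v"
  shows "le (x + u) (y + v)"
  using semiring_preorder_add_left[OF assms(1,2), of u]
    semiring_preorder_add_left[OF assms(1,3), of y] semiring_preorder_trans[OF assms(1)]
  by (metis add.commute)

lemma semiring_preorder_mult_cancel:
  fixes le :: "'a::semifield \<Rightarrow> 'a \<Rightarrow> bool"
  assumes "semiring_preorder le" "c \<noteq> 0" "le (c * x) (c * y)"
  shows "le x y"
proof -
  obtain d where d: "c * d = 1" using ex_mult_inverse assms(2) by blast
  have "d * (c * z) = z" for z by (metis d mult.commute mult.left_commute mult_1_right)
  then show ?thesis using semiring_preorder_mult_left[OF assms(1,3), of d] by simp
qed

lemma semifield_preorder_if_not_full: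
  assumes "semiring_preorder le" "\<not> le x y"
  shows "semifield_preorder le"
  unfolding semifield_preorder_def
proof (intro conjI notI assms(1))
  assume *: "le 1 0 \<and> le 0 1"
  then have "le x 0" "le 0 y"
    using semiring_preorder_mult_left[OF assms(1), of 1 0 x]
      semiring_preorder_mult_left[OF assms(1), of 0 1 y] by auto
  then show False using assms semiring_preorder_trans by blast
qed

section \<open>Divided differences without subtraction\<close>

text \<open>
  This is the formal quotient \<open>(a ^ i - b ^ i) / (a - b)\<close>, that is, \<open>\<Sum>k<i. a ^ k * b ^ (i - 1 - k)\<close>.
\<close>

primrec diff_quot_power :: "'a::comm_semiring_1 \<Rightarrow> 'a \<Rightarrow> nat \<Rightarrow> 'a" where
  "diff_quot_power a b 0 = 0"
| "diff_quot_power a b (Suc i) = a ^ i + b * diff_quot_power a b i"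

definition diff_quot :: "'a::comm_semiring_1 poly \<Rightarrow> 'a \<Rightarrow> 'a \<Rightarrow> 'a" where
  "diff_quot p a b = (\<Sum>i\<le>degree p. coeff p i * diff_quot_power a b i)"

text \<open>
  The terms \<open>a ^ k * b ^ l\<close> of total degree \<open>i + j - 1\<close> split according to whether \<open>k \<ge> i\<close>.
\<close>

lemma diff_quot_power_add:
  "diff_quot_power a b (i + j) = a ^ i * diff_quot_power a b j + b ^ j * diff_quot_power a b i"
  by (induction j) (simp_all add: power_add algebra_simps)

lemma diff_quot_power_exchange:
  "diff_quot_power a b j * a ^ i + diff_quot_power a b i * b ^ j =
   diff_quot_power a b j * b ^ i + diff_quot_power a b i * a ^ j"
  using diff_quot_power_add[of a b i j] diff_quot_power_add[of a b j i]
  by (simp add: ac_simps)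

text \<open>
  With subtraction the identity would read \<open>Q (p(a) - p(b)) = P (q(a) - q(b))\<close>, where both sides are
  \<open>(a - b) P Q\<close>. Without additive cancellation this is no proof. Instead, the identity is bilinear
  in the coefficients of \<open>p\<close> and \<open>q\<close>, and for two monomials \<open>X ^ i\<close> and \<open>X ^ j\<close> it holds because
  both sides equal the divided difference of \<open>X ^ (i + j)\<close>.
\<close>

lemma diff_quot_exchange:
  "diff_quot q a b * poly p a + diff_quot p a b * poly q b =
   diff_quot q a b * poly p b + diff_quot p a b * poly q a"
proof -
  let ?h = "diff_quot_power a b"
  have expand: "diff_quot q a b * poly p u + diff_quot p a b * poly q v =
      (\<Sum>i\<le>degree p. \<Sum>j\<le>degree q. coeff p i * coeff q j * (?h j * u ^ i + ?h i * v ^ j))"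
    for u v
  proof -
    have "diff_quot q a b * poly p u =
        (\<Sum>i\<le>degree p. \<Sum>j\<le>degree q. coeff p i * coeff q j * (?h j * u ^ i))"
      unfolding diff_quot_def poly_altdef sum_product
      by (subst sum.swap) (simp add: ac_simps)
    moreover have "diff_quot p a b * poly q v =
        (\<Sum>i\<le>degree p. \<Sum>j\<le>degree q. coeff p i * coeff q j * (?h i * v ^ j))"
      unfolding diff_quot_def poly_altdef sum_product by (simp add: ac_simps)
    ultimately show ?thesis by (simp add: sum.distrib distrib_left)
  qed
  show ?thesis unfolding expand
    by (intro sum.cong refl arg_cong[where f = "(*) _"] diff_quot_power_exchange)
qed

lemma diff_quot_power_eq_0_imp:
  fixes a b :: "'a::strict_semifield"
  assumes "diff_quot_power a b i = 0"
  shows "a ^ i = b ^ i"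
proof (cases i)
  case (Suc k)
  \<comment> \<open>The two extreme terms of the sum vanish.\<close>
  have "a ^ k = 0"
    using assms Suc add_eq_0_imp by simp blast
  moreover have "b ^ k = 0"
    using assms Suc diff_quot_power_add[of a b 1 k] add_eq_0_imp by simp blast
  ultimately show ?thesis using Suc by simp
qed simp

lemma diff_quot_eq_0_imp:
  fixes a b :: "'a::strict_semifield"
  assumes "diff_quot p a b = 0"
  shows "poly p a = poly p b"
proof -
  have "coeff p i * a ^ i = coeff p i * b ^ i" if "i \<le> degree p" for i
  proof -
    have "coeff p i * diff_quot_power a b i = 0"
      using strict_semifield_sum_eq_0_imp[of "{..degree p}"] assms that
      unfolding diff_quot_def by simp
    then show ?thesis using semifield_mult_eq_0_imp diff_quot_power_eq_0_imp by fastforce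
  qed
  then show ?thesis by (simp add: poly_altdef)
qed

section \<open>Forcing an inequality\<close>

definition adjoin :: "('a::comm_semiring_1 \<Rightarrow> 'a \<Rightarrow> bool) \<Rightarrow> 'a \<Rightarrow> 'a \<Rightarrow> 'a \<Rightarrow> 'a \<Rightarrow> bool" where
  "adjoin le a b x y \<longleftrightarrow> (\<exists>p. le x (poly p a) \<and> le (poly p b) y)"

lemma adjoin_extends:
  assumes "semiring_preorder le" "le x y"
  shows "adjoin le a b x y"
  unfolding adjoin_def using assms semiring_preorder_refl
  by (intro exI[of _ "[:y:]"]) auto

lemma adjoin_forces:
  assumes "semiring_preorder le"
  shows "adjoin le a b a b"
  unfolding adjoin_def using assms semiring_preorder_refl
  by (intro exI[of _ "[:0, 1:]"]) auto

text \<open>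
  If \<open>q(a) \<noteq> 0\<close>, then for \<open>r = p \<cdot> q / q(a)\<close> one has \<open>r(a) = p(a)\<close>, while \<open>r(b) = (p(b) / q(a)) q(b) \<le> q(b)\<close> because
  \<open>p(b) \<le> y \<le> q(a)\<close>.
\<close>

lemma adjoin_trans:
  fixes le :: "'a::strict_semifield \<Rightarrow> 'a \<Rightarrow> bool"
  assumes le: "semiring_preorder le" and "adjoin le a b x y" "adjoin le a b y z"
  shows "adjoin le a b x z"
proof -
  obtain p where p: "le x (poly p a)" "le (poly p b) y"
    using assms(2) adjoin_def by blast
  obtain q where q: "le y (poly q a)" "le (poly q b) z"
    using assms(3) adjoin_def by blast
  have pq: "le (poly p b) (poly q a)"
    using p(2) q(1) semiring_preorder_trans[OF le] by blast
  show ?thesis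
  proof (cases "poly q a = 0")
    case False
    then obtain d where d: "poly q a * d = 1" using ex_mult_inverse by blast
    let ?r = "smult d (p * q)"
    have "poly ?r a = poly p a * (poly q a * d)" by (simp add: ac_simps)
    then have "le x (poly ?r a)" using p d by simp
    moreover have "le (poly ?r b) (poly q b)"
    proof -
      have "poly ?r b = d * poly q b * poly p b" by (simp add: ac_simps)
      moreover have "d * poly q b * poly q a = poly q b * (poly q a * d)"
        by (simp only: ac_simps)
      ultimately show ?thesis
        using semiring_preorder_mult_left[OF le pq, of "d * poly q b"] d by simp
    qed
    then have "le (poly ?r b) z" using q(2) semiring_preorder_trans[OF le] by blast
    ultimately show ?thesis unfolding adjoin_def by blast
  next
    case True
    \<comment> \<open>Here \<open>p(b) \<le> 0\<close>, which absorbs \<open>p(b)\<close> into \<open>q(b)\<close>, so that \<open>p + q\<close> is a witness.\<close>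
    have "le (poly (p + q) b) (poly q b)"
      using semiring_preorder_add_left[OF le pq, of "poly q b"] True by (simp add: add.commute)
    then have "le (poly (p + q) b) z" using q(2) semiring_preorder_trans[OF le] by blast
    moreover have "le x (poly (p + q) a)" using p(1) True by simp
    ultimately show ?thesis unfolding adjoin_def by blast
  qed
qed

lemma semiring_preorder_adjoin:
  fixes le :: "'a::strict_semifield \<Rightarrow> 'a \<Rightarrow> bool"
  assumes le: "semiring_preorder le"
  shows "semiring_preorder (adjoin le a b)"
  unfolding semiring_preorder_def
proof (intro conjI allI impI)
  show "reflp (adjoin le a b)"
    using adjoin_extends[OF le] semiring_preorder_refl[OF le] by (simp add: reflp_def)
  show "transp (adjoin le a b)"
    using adjoin_trans[OF le] by (intro transpI)
  fix c x y
  assume "adjoin le a b x y"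
  then obtain p where p: "le x (poly p a)" "le (poly p b) y"
    using adjoin_def by blast
  show "adjoin le a b (c + x) (c + y)"
    unfolding adjoin_def using p semiring_preorder_add_left[OF le]
    by (intro exI[of _ "[:c:] + p"]) simp
  show "adjoin le a b (c * x) (c * y)"
    unfolding adjoin_def using p semiring_preorder_mult_left[OF le]
    by (intro exI[of _ "smult c p"]) simp
qed

text \<open>
  Weighting \<open>x \<le> p(a)\<close> by \<open>Q\<close> and \<open>x \<le> q(b)\<close> by \<open>P\<close> makes the right-hand sides add up to the
  same element as the correspondingly weighted left-hand sides of \<open>p(b) \<le> y\<close> and \<open>q(a) \<le> y\<close>.
\<close>

lemma adjoin_both_imp:
  fixes le :: "'a::strict_semifield \<Rightarrow> 'a \<Rightarrow> bool"
  assumes le: "semiring_preorder le" and "adjoin le a b x y" "adjoin le b a x y"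
  shows "le x y"
proof -
  obtain p where p: "le x (poly p a)" "le (poly p b) y"
    using assms(2) adjoin_def by blast
  obtain q where q: "le x (poly q b)" "le (poly q a) y"
    using assms(3) adjoin_def by blast
  let ?P = "diff_quot p a b" and ?Q = "diff_quot q a b"
  show ?thesis
  proof (cases "?Q + ?P = 0")
    case True
    then have "poly p a = poly p b" using add_eq_0_imp diff_quot_eq_0_imp by blast
    then have "le (poly p a) y" using p(2) by simp
    with p(1) show ?thesis by (rule semiring_preorder_trans[OF le])
  next
    case False
    have "le (?Q * x + ?P * x) (?Q * poly p a + ?P * poly q b)"
      by (intro semiring_preorder_add_mono[OF le] semiring_preorder_mult_left[OF le] p q)
    moreover have "le (?Q * poly p b + ?P * poly q a) (?Q * y + ?P * y)"
      by (intro semiring_preorder_add_mono[OF le] semiring_preorder_mult_left[OF le] p q)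
    ultimately have "le (?Q * x + ?P * x) (?Q * y + ?P * y)"
      unfolding diff_quot_exchange[of q a b p] by (rule semiring_preorder_trans[OF le])
    then have "le ((?Q + ?P) * x) ((?Q + ?P) * y)" by (simp add: distrib_right)
    then show ?thesis using semiring_preorder_mult_cancel[OF le False] by blast
  qed
qed

section \<open>Maximal preorders\<close>

text \<open>
  Relations are passed to Zorn's lemma as sets of pairs, ordered by inclusion; a chain of semiring
  preorders has its union as an upper bound because each closure condition involves at most two
  related pairs, both of which lie in a common member of the chain.
\<close>

lemma ex_maximal_semiring_preorder:
  fixes le :: "'a::comm_semiring_1 \<Rightarrow> 'a \<Rightarrow> bool"
  assumes le: "semiring_preorder le" and nle: "\<not> le x y"
  obtains m where "semiring_preorder m" "\<And>a b. le a b \<Longrightarrow> m a b" "\<not> m x y"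
    and "\<And>m' a b. semiring_preorder m' \<Longrightarrow> (\<And>a b. m a b \<Longrightarrow> m' a b) \<Longrightarrow> \<not> m' x y \<Longrightarrow>
      m' a b \<Longrightarrow> m a b"
proof -
  define rel :: "('a \<times> 'a) set \<Rightarrow> 'a \<Rightarrow> 'a \<Rightarrow> bool" where "rel R = (\<lambda>a b. (a, b) \<in> R)" for R
  define \<A> where "\<A> = {R. semiring_preorder (rel R) \<and> (\<forall>a b. le a b \<longrightarrow> (a, b) \<in> R) \<and> (x, y) \<notin> R}"
  have "{(a, b). le a b} \<in> \<A>" using le nle by (simp add: \<A>_def rel_def)
  moreover have "\<Union>\<C> \<in> \<A>" if ne: "\<C> \<noteq> {}" and chain: "subset.chain \<A> \<C>" for \<C>
  proof -
    have sub: "R \<in> \<A>" if "R \<in> \<C>" for R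
      using chain that by (auto simp: subset_chain_def)
    then have pre: "semiring_preorder (rel R)" if "R \<in> \<C>" for R
      using that by (simp add: \<A>_def)
    have "semiring_preorder (rel (\<Union>\<C>))"
      unfolding semiring_preorder_def
    proof (intro conjI allI impI)
      show "reflp (rel (\<Union>\<C>))"
        using ne semiring_preorder_refl[OF pre] by (fastforce simp: reflp_def rel_def)
      show "transp (rel (\<Union>\<C>))"
      proof (rule transpI)
        fix a b c
        assume "rel (\<Union>\<C>) a b" "rel (\<Union>\<C>) b c"
        then obtain R S where "R \<in> \<C>" "(a, b) \<in> R" "S \<in> \<C>" "(b, c) \<in> S"
          by (auto simp: rel_def)
        then obtain T where T: "T \<in> \<C>" "(a, b) \<in> T" "(b, c) \<in> T"
          using chain by (metis subset_chain_def subsetD)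
        then show "rel (\<Union>\<C>) a c"
          using semiring_preorder_trans[OF pre[OF T(1)], of a b c] by (auto simp: rel_def)
      qed
      fix c a b
      assume "rel (\<Union>\<C>) a b"
      then obtain R where R: "R \<in> \<C>" "rel R a b" by (auto simp: rel_def)
      show "rel (\<Union>\<C>) (c + a) (c + b)"
        using R semiring_preorder_add_left[OF pre] by (fastforce simp: rel_def)
      show "rel (\<Union>\<C>) (c * a) (c * b)"
        using R semiring_preorder_mult_left[OF pre] by (fastforce simp: rel_def)
    qed
    then show ?thesis using ne sub by (auto simp: \<A>_def)
  qed
  ultimately obtain M where M: "M \<in> \<A>" and max: "\<And>R. R \<in> \<A> \<Longrightarrow> M \<subseteq> R \<Longrightarrow> R = M"
    using subset_Zorn_nonempty[of \<A>] by blast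
  show thesis
  proof (rule that[of "rel M"])
    show "semiring_preorder (rel M)" "\<not> rel M x y" "\<And>a b. le a b \<Longrightarrow> rel M a b"
      using M by (auto simp: \<A>_def rel_def)
    fix m' a b
    assume m': "semiring_preorder m'" "\<And>a b. rel M a b \<Longrightarrow> m' a b" "\<not> m' x y" "m' a b"
    have "{(a, b). m' a b} = M"
      using M m'(1-3) by (intro max) (auto simp: \<A>_def rel_def)
    then show "rel M a b" using m'(4) by (auto simp: rel_def)
  qed
qed

lemma ex_total_semifield_preorder_avoiding:
  fixes le :: "'a::strict_semifield \<Rightarrow> 'a \<Rightarrow> bool"
  assumes le: "semiring_preorder le" and nle: "\<not> le x y"
  obtains m where "semifield_preorder m" "totalp m" "\<And>a b. le a b \<Longrightarrow> m a b" "\<not> m x y"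
proof -
  obtain m where m: "semiring_preorder m" "\<And>a b. le a b \<Longrightarrow> m a b" "\<not> m x y"
    and max: "\<And>m' a b. semiring_preorder m' \<Longrightarrow> (\<And>a b. m a b \<Longrightarrow> m' a b) \<Longrightarrow> \<not> m' x y \<Longrightarrow>
      m' a b \<Longrightarrow> m a b"
    using ex_maximal_semiring_preorder[OF le nle] by blast
  have forced: "adjoin m a b x y" if "\<not> m a b" for a b
    using max[OF semiring_preorder_adjoin[OF m(1)] adjoin_extends[OF m(1)]]
      adjoin_forces[OF m(1)] that by blast
  have "m a b \<or> m b a" for a b
    using forced adjoin_both_imp[OF m(1)] m(3) by blast
  then have "totalp m" by (simp add: totalp_on_def)
  then show thesis using that m semifield_preorder_if_not_full by blast
qed

section \<open>The intersection of the total extensions\<close>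

theorem theorem6p6:
  fixes le :: "'a::strict_semifield \<Rightarrow> 'a \<Rightarrow> bool"
  assumes "semifield_preorder le"
  shows "\<forall>x y. le x y \<longleftrightarrow>
    (\<forall>pr. semifield_preorder pr \<and> totalp pr \<and> (\<forall>a b. le a b \<longrightarrow> pr a b) \<longrightarrow> pr x y)"
proof -
  have le: "semiring_preorder le" using assms unfolding semifield_preorder_def by blast
  show ?thesis
  proof (intro allI iffI impI)
    fix x y
    assume total: "\<forall>pr. semifield_preorder pr \<and> totalp pr \<and> (\<forall>a b. le a b \<longrightarrow> pr a b) \<longrightarrow> pr x y"
    show "le x y"
    proof (rule ccontr)
      assume "\<not> le x y"
      then obtain m where m: "semifield_preorder m" "totalp m" "\<And>a b. le a b \<Longrightarrow> m a b" "\<not> m x y"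
        using ex_total_semifield_preorder_avoiding[OF le] by blast
      then show False using total[rule_format, of m] by simp
    qed
  next
    fix x y pr
    assume "le x y" "semifield_preorder pr \<and> totalp pr \<and> (\<forall>a b. le a b \<longrightarrow> pr a b)"
    then show "pr x y" by simp
  qed
qed

end
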